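(* Let $n \geq 1$ be an integer, $\mathbb{F}_q$ a finite field, $\epsilon \in \{\pm 1\}^n$ a sign pattern, and $A_\epsilon \in LPM_n^{\mathbb{F}_q}(\epsilon)$ a given matrix. Then: (1) For each invertible lower triangular $L \in \mathbb{F}_q^{n\times n}$, the matrix $L A_\epsilon L^T$ belongs to $LPM_n^{\mathbb{F}_q}(\epsilon)$. (2) If $\mathbb{F}_q$ is a definite field or has characteristic $2$, then for each $A \in LPM_n^{\mathbb{F}_q}(\epsilon)$ there exists a unique lower triangular matrix $L \in \mathbb{F}_q^{n\times n}$ with positive diagonal entries such that $A = L A_\epsilon L^T$. Moreover, each of the following maps is a bijection: (3) $LPM_n^{\mathbb{F}_q}(\epsilon) \to TPM_n^{\mathbb{F}_q}(\epsilon)$, $A \mapsto \nabla A \nabla$; (4) $LPM_n^{\mathbb{F}_q}(\epsilon) \to TPM_n^{\mathbb{F}_q}(\epsilon')$, $A \mapsto A^{-1}$, where $\epsilon' = (\epsilon_n\epsilon_{n-1}, \epsilon_n\epsilon_{n-2}, \dots, \epsilon_n\epsilon_1, \epsilon_n)$. Finally, the analogues of (1) and (2) hold for each fixed $A^\epsilon \in TPM_n^{\mathbb{F}_q}(\epsilon)$: (5) for each invertible upper triangular $U \in \mathbb{F}_q^{n\times n}$, the matrix $U A^\epsilon U^T$ belongs to $TPM_n^{\mathbb{F}_q}(\epsilon)$; (6) if $\mathbb{F}_q$ is a definite field or has characteristic $2$, then for each $A \in TPM_n^{\mathbb{F}_q}(\epsilon)$ there exists a unique upper triangular matrix $U \in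 \mathbb{F}_q^{n\times n}$ with positive diagonal entries such that $A = U A^\epsilon U^T$.
   Context: $\mathbb{F}_q$ is the finite field with $q = p^k$ elements ($p$ prime, $k \geq 1$). An element $a \in \mathbb{F}_q^\times$ is positive if $a = b^2$ for some $b \in \mathbb{F}_q^\times$, and negative otherwise; $\mathbb{F}_q^+$ and $\mathbb{F}_q^-$ denote the sets of positive and negative elements. The quadratic character $\chi$ takes the value $1$ on $\mathbb{F}_q^+$, $-1$ on $\mathbb{F}_q^-$, and $\chi(0)=0$. The field $\mathbb{F}_q$ is called definite if $q \equiv 3 \pmod 4$. For $\epsilon \in \{\pm1\}^n$, $LPM_n^{\mathbb{F}_q}(\epsilon)$ is the set of symmetric matrices $A \in \mathbb{F}_q^{n\times n}$ such that for each $k = 1, \dots, n$ the $k \times k$ leading principal minor (upper-left corner) of $A$ has quadratic character $\epsilon_k$. Similarly, $TPM_n^{\mathbb{F}_q}(\epsilon)$ is the set of symmetric matrices $A \in \mathbb{F}_q^{n\times n}$ such that for each $k=1,\dots,n$ the $k\times k$ trailing principal minor (lower-right corner) of $A$ has quadratic character $\epsilon_k$. $LPM_n^{\mathbb{F}_q}$ (resp. $TPM_n^{\mathbb{F}_q}$) is the set of all symmetric matrices in $\mathbb{F}_q^{n\times n}$ with all leading (resp. trailing) principal minors nonzero. Convention: when $q$ is even (so all nonzero elements are positive), $LPM_n^{\mathbb{F}_q}(\epsilon) := LPM_n^{\mathbb{F}_q}$ and $TPM_n^{\mathbb{F}_q}(\epsilon) := TPM_n^{\mathbb{F}_q}$ for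 every $\epsilon$. $\nabla \in \mathbb{F}_q^{n\times n}$ is the matrix with $1$'s on the anti-diagonal (entries $(i, n+1-i)$) and $0$ elsewhere. *)

theory Defs
  imports
    "Jordan_Normal_Form.Gauss_Jordan_Elimination"
    "Jordan_Normal_Form.Determinant"
    "Jordan_Normal_Form.DL_Submatrix"
    "HOL-Library.Cardinality"
begin

text \<open>
  The finite field with \<open>q\<close> elements is a type \<open>'a :: {field, finite}\<close> with \<open>q = CARD('a)\<close>.
\<close>

definition positive_elem :: "'a :: field \<Rightarrow> bool" where
  "positive_elem a \<longleftrightarrow> (\<exists>b. b \<noteq> 0 \<and> a = b ^ 2)"

definition negative_elem :: "'a :: field \<Rightarrow> bool" where
  "negative_elem a \<longleftrightarrow> a \<noteq> 0 \<and> \<not> positive_elem a"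

definition quadratic_char :: "'a :: field \<Rightarrow> int" where
  "quadratic_char a = (if positive_elem a then 1 else if negative_elem a then - 1 else 0)"

definition definite_field :: "'a :: {field, finite} itself \<Rightarrow> bool" where
  "definite_field _ \<longleftrightarrow> CARD('a) mod 4 = 3"

definition symmetric_mat :: "'a mat \<Rightarrow> bool" where
  "symmetric_mat A \<longleftrightarrow> transpose_mat A = A"

definition lower_triangular :: "'a :: zero mat \<Rightarrow> bool" where
  "lower_triangular A \<longleftrightarrow> (\<forall>i < dim_row A. \<forall>j < dim_col A. i < j \<longrightarrow> A $$ (i, j) = 0)"

definition leading_minor :: "'a :: comm_ring_1 mat \<Rightarrow> nat \<Rightarrow> 'a" where
  "leading_minor A k = det (submatrix A {..<k} {..<k})"

text \<open>For square matrices: the lower-right corner consists of the last \<open>k\<close> indices.\<close>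

definition trailing_minor :: "'a :: comm_ring_1 mat \<Rightarrow> nat \<Rightarrow> 'a" where
  "trailing_minor A k =
     (let I = {dim_row A - k..<dim_row A} in det (submatrix A I I))"

definition LPM_all :: "nat \<Rightarrow> 'a :: {field, finite} mat set" where
  "LPM_all n = {A \<in> carrier_mat n n. symmetric_mat A \<and> (\<forall>k\<in>{1..n}. leading_minor A k \<noteq> 0)}"

definition TPM_all :: "nat \<Rightarrow> 'a :: {field, finite} mat set" where
  "TPM_all n = {A \<in> carrier_mat n n. symmetric_mat A \<and> (\<forall>k\<in>{1..n}. trailing_minor A k \<noteq> 0)}"

text \<open>
  A sign pattern in \<open>{1, -1}\<^sup>n\<close> is a function of which only the values at \<open>1, \<dots>, n\<close> are used.
  For even \<open>q\<close> every nonzero element is a square, and by convention the sign pattern is ignored.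
\<close>

definition sign_pattern :: "nat \<Rightarrow> (nat \<Rightarrow> int) \<Rightarrow> bool" where
  "sign_pattern n \<epsilon> \<longleftrightarrow> (\<forall>k\<in>{1..n}. \<epsilon> k \<in> {1, - 1})"

definition LPM :: "nat \<Rightarrow> (nat \<Rightarrow> int) \<Rightarrow> 'a :: {field, finite} mat set" where
  "LPM n \<epsilon> = (if even CARD('a) then LPM_all n
     else {A \<in> carrier_mat n n. symmetric_mat A \<and>
             (\<forall>k\<in>{1..n}. quadratic_char (leading_minor A k) = \<epsilon> k)})"

definition TPM :: "nat \<Rightarrow> (nat \<Rightarrow> int) \<Rightarrow> 'a :: {field, finite} mat set" where
  "TPM n \<epsilon> = (if even CARD('a) then TPM_all n
     else {A \<in> carrier_mat n n. symmetric_mat A \<and>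
             (\<forall>k\<in>{1..n}. quadratic_char (trailing_minor A k) = \<epsilon> k)})"

text \<open>
  The pattern \<open>(\<epsilon>\<^sub>n \<epsilon>\<^bsub>n-1\<^esub>, \<epsilon>\<^sub>n \<epsilon>\<^bsub>n-2\<^esub>, \<dots>, \<epsilon>\<^sub>n \<epsilon>\<^sub>1, \<epsilon>\<^sub>n)\<close>.
\<close>

definition inverse_pattern :: "nat \<Rightarrow> (nat \<Rightarrow> int) \<Rightarrow> nat \<Rightarrow> int" where
  "inverse_pattern n \<epsilon> k = (if k < n then \<epsilon> n * \<epsilon> (n - k) else \<epsilon> n)"

text \<open>With indices starting at 0, the anti-diagonal is \<open>i + j = n - 1\<close>.\<close>

definition nabla_mat :: "nat \<Rightarrow> 'a :: zero_neq_one mat" where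
  "nabla_mat n = mat n n (\<lambda>(i, j). if i + j + 1 = n then 1 else 0)"

end

theory Submission
  imports Defs "HOL-Number_Theory.Residues"
begin

text \<open>For lower triangular \<open>L\<close> the leading blocks satisfy \<open>(L A L\<^sup>T)\<^sub>k = L\<^sub>k A\<^sub>k L\<^sub>k\<^sup>T\<close>, so leading
  minors change by nonzero squares. Conversely \<open>L\<close> is recovered from \<open>A\<close> one row at a time, the only
  choice being that of a square root for each diagonal entry; definite fields and fields of
  characteristic 2 are those where every positive element has exactly one positive square root.
  Conjugation by \<open>\<nabla>\<close> reverses the order of the indices and carries everything over to trailing minors,
  and the statement on inverses is Jacobi's complementary minor formula together with the
  multiplicativity of the quadratic character.\<close>

section \<open>Squares in finite fields\<close>

text \<open>A unique positive root helps only if a root exists: the ratio of corresponding minors of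
  \<open>A\<close> and \<open>A\<^sub>\<epsilon>\<close> must be a square. In odd characteristic
  equal signs ensure this because the product of two nonsquares is again a square, a property of
  finite fields that needs a counting argument. Solving for the last row of \<open>L\<close> uses
  only part of the equation \<open>A = L * A\<^sub>\<epsilon> * L\<^sup>T\<close>. The remaining
  corner entry is not computed: a symmetric matrix whose leading block of size one less is regular
  is determined by that block, its last column and its determinant. The pattern \<epsilon>' has this
  origin: if \<open>M k\<close> are the leading minors of \<open>A\<close>, with
  \<open>M 0 = 1\<close>, then the trailing minors of the inverse are
  \<open>M (n - k) / M n\<close>. An element and its inverse have the same quadratic character, so
  the quotient has sign \<open>\<epsilon> n * \<epsilon> (n - k)\<close>, and
  \<open>\<epsilon> n\<close> for \<open>k = n\<close>.\<close>

lemma positive_elem_nonzero: "positive_elem a \<Longrightarrow> a \<noteq> 0"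
  by (auto simp: positive_elem_def)

lemma positive_elem_mult: "positive_elem a \<Longrightarrow> positive_elem b \<Longrightarrow> positive_elem (a * b)"
  unfolding positive_elem_def by (metis mult_eq_0_iff power_mult_distrib)

lemma positive_elem_divide: "positive_elem a \<Longrightarrow> positive_elem b \<Longrightarrow> positive_elem (a / b)"
  unfolding positive_elem_def by (metis divide_eq_0_iff power_divide)

lemma positive_elem_square: "c \<noteq> 0 \<Longrightarrow> positive_elem (c ^ 2)"
  unfolding positive_elem_def by auto

text \<open>Every fibre of squaring has at most two elements, so at least half of the nonzero
  elements are positive. For negative \<open>a\<close> the set \<open>S\<close> of positive elements and its translate
  \<open>a S\<close> are disjoint and hence exhaust the nonzero elements.\<close>

lemma positive_elem_mult_negative:
  fixes a b :: "'a :: {field, finite}"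
  assumes a: "negative_elem a" and b: "negative_elem b"
  shows "positive_elem (a * b)"
proof -
  define S where "S = {x :: 'a. positive_elem x}"
  have a0: "a \<noteq> 0" and b0: "b \<noteq> 0"
    using a b by (auto simp: negative_elem_def)
  have fibre: "card {x. x ^ 2 = s} \<le> 2" for s :: 'a
  proof (cases "\<exists>x. x ^ 2 = s")
    case True
    then obtain x where "x ^ 2 = s"
      by blast
    then have "{y. y ^ 2 = s} \<subseteq> {x, - x}"
      by (auto simp: power2_eq_iff)
    then have "card {y. y ^ 2 = s} \<le> card {x, - x}"
      by (intro card_mono) auto
    also have "\<dots> \<le> 2"
      by (simp add: card_insert_if)
    finally show ?thesis .
  qed simp
  have "UNIV - {0} = (\<Union>s\<in>S. {x. x ^ 2 = s})"
    by (auto simp: S_def positive_elem_def)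
  then have "card (UNIV - {0 :: 'a}) \<le> (\<Sum>s\<in>S. card {x. x ^ 2 = s})"
    by (simp add: card_UN_le)
  also have "\<dots> \<le> (\<Sum>s\<in>S. 2)"
    by (intro sum_mono fibre)
  finally have half: "card (UNIV - {0 :: 'a}) \<le> 2 * card S"
    by simp
  have disj: "S \<inter> (*) a ` S = {}"
  proof (rule ccontr)
    assume "S \<inter> (*) a ` S \<noteq> {}"
    then obtain s where s: "positive_elem s" "positive_elem (a * s)"
      by (auto simp: S_def)
    from positive_elem_divide[OF s(2,1)] have "positive_elem a"
      using positive_elem_nonzero[OF s(1)] by simp
    with a show False
      by (simp add: negative_elem_def)
  qed
  have "card (S \<union> (*) a ` S) = 2 * card S"
    using disj a0 by (subst card_Un_disjoint) (auto simp: card_image inj_on_def)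
  moreover have sub: "S \<union> (*) a ` S \<subseteq> UNIV - {0}"
    using a0 by (auto simp: S_def dest: positive_elem_nonzero)
  ultimately have "S \<union> (*) a ` S = UNIV - {0}"
    using half by (intro card_seteq) auto
  with b b0 obtain s where "positive_elem s" "b = a * s"
    by (auto simp: S_def negative_elem_def)
  then have "a * b = a ^ 2 * s" "positive_elem s"
    by (auto simp: power2_eq_square)
  then show ?thesis
    using positive_elem_mult positive_elem_square[OF a0] by metis
qed

lemma positive_elem_mult_iff:
  assumes "positive_elem a" shows "positive_elem (a * b) \<longleftrightarrow> positive_elem b"
  using positive_elem_divide[of "a * b" a] positive_elem_mult[OF assms]
    assms positive_elem_nonzero[OF assms] by auto

text \<open>Positive elements form a group, which settles the cases with a positive factor. The case
  of two negative factors is the one that uses finiteness.\<close>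

lemma quadratic_char_mult:
  fixes a b :: "'a :: {field, finite}"
  shows "quadratic_char (a * b) = quadratic_char a * quadratic_char b"
proof -
  consider "a = 0" | "b = 0" | "positive_elem a" | "positive_elem b"
    | "negative_elem a" "negative_elem b"
    by (auto simp: negative_elem_def)
  then show ?thesis
  proof cases
    case 5
    then show ?thesis
      using positive_elem_mult_negative[OF 5] by (auto simp: quadratic_char_def negative_elem_def)
  qed (use positive_elem_mult_iff[of a b] positive_elem_mult_iff[of b a] positive_elem_nonzero
      in \<open>auto simp: quadratic_char_def negative_elem_def mult.commute\<close>)
qed

lemma quadratic_char_eq_0_iff: "quadratic_char a = 0 \<longleftrightarrow> a = 0"
  by (auto simp: quadratic_char_def negative_elem_def dest: positive_elem_nonzero)

lemma quadratic_char_eq_1_iff: "quadratic_char a = 1 \<longleftrightarrow> positive_elem a"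
  by (auto simp: quadratic_char_def)

text \<open>The inverse of a square is the square of the inverse, and \<open>inverse 0 = 0\<close>
  covers zero. This turns signs of quotients of minors into products of signs.\<close>

lemma quadratic_char_inverse:
  "quadratic_char (inverse a) = quadratic_char a"
proof -
  have "positive_elem (inverse a) \<longleftrightarrow> positive_elem a"
    unfolding positive_elem_def
    by (metis inverse_inverse_eq inverse_zero power_inverse)
  then show ?thesis
    by (simp add: quadratic_char_def negative_elem_def)
qed

section \<open>Square roots in definite fields and in characteristic 2\<close>

text \<open>Multiplication by \<open>b\<close> permutes the nonzero elements, so their product
  \<open>?P\<close> equals \<open>b ^ (CARD('a) - 1) * ?P\<close>, and \<open>?P\<close>
  cancels.\<close>

lemma nonzero_power_card_minus_1:
  fixes b :: "'a :: {field, finite}"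
  assumes "b \<noteq> 0"
  shows "b ^ (CARD('a) - 1) = 1"
proof -
  let ?P = "\<Prod>x\<in>UNIV - {0 :: 'a}. x"
  have "bij_betw ((*) b) (UNIV - {0}) (UNIV - {0})"
    using assms by (intro bij_betw_byWitness[of _ "\<lambda>x. x / b"]) auto
  then have "?P = (\<Prod>x\<in>UNIV - {0}. b * x)"
    by (rule prod.reindex_bij_betw[symmetric])
  also have "\<dots> = b ^ (CARD('a) - 1) * ?P"
    by (simp add: prod.distrib card_Diff_singleton)
  finally show ?thesis
    by simp
qed

text \<open>For q = 4m + 3 the exponent q - 1 = 2(2m + 1) is twice an odd number. A root b of -1
  would give 1 = b^(q-1) = (-1)^(2m+1) = -1, hence characteristic 2, although q is odd.\<close>

lemma minus_one_not_positive:
  assumes "definite_field TYPE('a :: {field, finite})"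
  shows "\<not> positive_elem (- 1 :: 'a)"
proof
  assume "positive_elem (- 1 :: 'a)"
  then obtain b :: 'a where b: "b ^ 2 = - 1" "b \<noteq> 0"
    by (auto simp: positive_elem_def)
  have q: "CARD('a) mod 4 = 3"
    using assms by (simp add: definite_field_def)
  define m where "m = CARD('a) div 4"
  have "CARD('a) = Suc (2 * (2 * m + 1))"
    using q unfolding m_def by presburger
  then have "b ^ (CARD('a) - 1) = (b ^ 2) ^ (2 * m + 1)"
    by (simp only: diff_Suc_1 power_mult)
  then have "(- 1 :: 'a) = 1"
    using nonzero_power_card_minus_1[OF b(2)] by (simp add: b(1))
  then have "(2 :: 'a) = 0"
    by (metis add.right_inverse one_add_one)
  then have "CHAR('a) dvd 2"
    using of_nat_eq_0_iff_char_dvd[of 2, where ?'a = 'a] by simp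
  then have "CHAR('a) = 2"
    using CHAR_not_1[where ?'a = 'a]
    by (metis CHAR_not_1' One_nat_def dvd_refl nat_dvd_not_less prime_nat_iff two_is_prime_nat)
  then have "even CARD('a)"
    using CHAR_dvd_CARD[where ?'a = 'a] by simp
  then show False
    using q by presburger
qed

lemma char_2_power2_inj:
  assumes "CHAR('a :: field) = 2" "x ^ 2 = (y :: 'a) ^ 2"
  shows "x = y"
proof -
  have "(2 :: 'a) = 0"
    using of_nat_CHAR[where ?'a = 'a] assms(1) by simp
  then have "- y = y"
    by (metis add.inverse_unique mult_2 mult_zero_left)
  then show ?thesis
    using assms(2) by (auto simp: power2_eq_iff)
qed

text \<open>Squaring is injective here, hence surjective on a finite field, so every element is a
  square.\<close>

lemma char_2_positive_elem_iff:
  assumes "CHAR('a :: {field, finite}) = 2"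
  shows "positive_elem (a :: 'a) \<longleftrightarrow> a \<noteq> 0"
proof -
  have "inj (\<lambda>x :: 'a. x ^ 2)"
    using char_2_power2_inj[OF assms] by (auto simp: inj_def)
  then have "surj (\<lambda>x :: 'a. x ^ 2)"
    by (intro finite_UNIV_inj_surj) auto
  then obtain b where "a = b ^ 2"
    by blast
  then show ?thesis
    by (auto simp: positive_elem_def)
qed

text \<open>The roots of \<open>c\<close> are \<open>b\<close> and \<open>- b\<close>. If -1 is
  negative, multiplicativity gives them opposite signs, so exactly one is positive. In
  characteristic 2 they coincide, and every nonzero element is positive.\<close>

lemma ex1_positive_sqrt:
  fixes c :: "'a :: {field, finite}"
  assumes F: "definite_field TYPE('a) \<or> CHAR('a) = 2" and c: "positive_elem c"
  shows "\<exists>!y. positive_elem y \<and> y ^ 2 = c"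
proof -
  from c obtain b where b: "b \<noteq> 0" "c = b ^ 2"
    by (auto simp: positive_elem_def)
  show ?thesis
  proof (cases "CHAR('a) = 2")
    case True
    then show ?thesis
      using b char_2_positive_elem_iff[OF True] char_2_power2_inj[OF True] by (intro ex1I[of _ b]) auto
  next
    case False
    then have neg: "\<not> positive_elem (- 1 :: 'a)"
      using F minus_one_not_positive by blast
    have minus: "positive_elem (- y) \<longleftrightarrow> \<not> positive_elem y" if "y \<noteq> 0" for y :: 'a
    proof -
      have "quadratic_char (- y) = - quadratic_char y"
        using quadratic_char_mult[of "- 1" y] neg
        by (simp add: quadratic_char_def[of "- 1"] negative_elem_def)
      then show ?thesis
        using that by (auto simp: quadratic_char_def negative_elem_def split: if_splits)
    qed
    define y where "y = (if positive_elem b then b else - b)"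
    have "positive_elem y" "y ^ 2 = c"
      using minus[OF b(1)] b(2) by (auto simp: y_def)
    moreover have "z = y" if "positive_elem z" "z ^ 2 = c" for z
      using that minus[OF positive_elem_nonzero[OF \<open>positive_elem y\<close>]] \<open>positive_elem y\<close> \<open>y ^ 2 = c\<close>
      by (metis power2_eq_iff)
    ultimately show ?thesis
      by blast
  qed
qed

section \<open>Sign conditions uniform in the parity of q\<close>

text \<open>Merges the two branches of \<open>LPM\<close> and \<open>TPM\<close>, so that the
  arguments about matrices need no distinction between even and odd \<open>q\<close>.\<close>

definition has_sign :: "int \<Rightarrow> 'a :: {field, finite} \<Rightarrow> bool" where
  "has_sign e a \<longleftrightarrow> (if even CARD('a) then a \<noteq> 0 else quadratic_char a = e)"

text \<open>The value \<open>e = 0\<close> has to be excluded: for odd \<open>q\<close>,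
  \<open>has_sign 0 a\<close> says \<open>a = 0\<close>.\<close>

lemma has_sign_nonzero: "has_sign e a \<Longrightarrow> e \<in> {1, - 1} \<Longrightarrow> a \<noteq> 0"
  using quadratic_char_eq_0_iff[of a] by (auto simp: has_sign_def split: if_splits)

lemma has_sign_one: "has_sign 1 1"
  using quadratic_char_eq_1_iff[of 1] by (auto simp: has_sign_def positive_elem_def intro: exI[of _ 1])

lemma has_sign_square_mult: "has_sign e a \<Longrightarrow> c \<noteq> 0 \<Longrightarrow> has_sign e (c ^ 2 * a)"
  using quadratic_char_eq_1_iff[of "c ^ 2"] positive_elem_square[of c]
  by (auto simp: has_sign_def quadratic_char_mult split: if_splits)

lemma has_sign_divide:
  "has_sign e a \<Longrightarrow> has_sign f b \<Longrightarrow> f \<in> {1, - 1} \<Longrightarrow> has_sign (f * e) (a / b)"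
  using has_sign_nonzero[of f b]
  by (auto simp: has_sign_def field_class.field_divide_inverse quadratic_char_mult
      quadratic_char_inverse split: if_splits)

text \<open>In a definite field the sign of the quotient is \<open>e * e = 1\<close>; in
  characteristic 2 it is enough that the quotient is nonzero. Applied to minors, this provides the
  square ratios from which the diagonal of \<open>L\<close> is extracted.\<close>

lemma has_sign_imp_positive_ratio:
  fixes a b :: "'a :: {field, finite}"
  assumes "definite_field TYPE('a) \<or> CHAR('a) = 2" "e \<in> {1, - 1}" "has_sign e a" "has_sign e b"
  shows "positive_elem (a / b)"
proof (cases "CHAR('a) = 2")
  case True
  then show ?thesis
    using has_sign_nonzero[OF assms(3,2)] has_sign_nonzero[OF assms(4,2)]
    by (simp add: char_2_positive_elem_iff)
next
  case False
  then have "CARD('a) mod 4 = 3"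
    using assms(1) by (simp add: definite_field_def)
  then have "odd CARD('a)"
    by presburger
  then have "quadratic_char (a / b) = 1"
    using has_sign_divide[OF assms(3,4,2)] assms(2) by (auto simp: has_sign_def)
  then show ?thesis
    by (simp add: quadratic_char_eq_1_iff)
qed

text \<open>\<open>M k\<close> stands for a leading or a trailing minor of size \<open>k\<close>;
  keeping it abstract serves both directions of inversion. The empty minor \<open>M 0 = 1\<close>
  explains the last entry of the pattern, where the quotient is \<open>1 / M n\<close>.\<close>

lemma has_sign_inverse_pattern:
  assumes \<epsilon>: "sign_pattern n \<epsilon>" and k: "k \<in> {1..n}"
    and M: "M 0 = 1" "\<And>k. k \<in> {1..n} \<Longrightarrow> has_sign (\<epsilon> k) (M k)"
  shows "has_sign (inverse_pattern n \<epsilon> k) (M (n - k) / M n)"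
proof -
  have n: "has_sign (\<epsilon> n) (M n)" "\<epsilon> n \<in> {1, - 1}"
    using k M(2)[of n] \<epsilon> by (auto simp: sign_pattern_def)
  show ?thesis
  proof (cases "k < n")
    case True
    then show ?thesis
      using has_sign_divide[OF M(2)[of "n - k"] n] k by (simp add: inverse_pattern_def)
  next
    case False
    then show ?thesis
      using has_sign_divide[OF has_sign_one n] k M(1) by (simp add: inverse_pattern_def)
  qed
qed

section \<open>Leading and trailing blocks\<close>

text \<open>An explicit \<open>mat\<close> replaces \<open>submatrix\<close>, so that entries are
  reached by index arithmetic and not through \<open>pick\<close>.\<close>

abbreviation leading_block :: "nat \<Rightarrow> 'a mat \<Rightarrow> 'a mat" where
  "leading_block k A \<equiv> mat k k (($$) A)"

definition trailing_block :: "nat \<Rightarrow> 'a mat \<Rightarrow> 'a mat" where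
  "trailing_block k A = mat k k (\<lambda>(i, j). A $$ (dim_row A - k + i, dim_col A - k + j))"

lemma leading_block_dim: "A \<in> carrier_mat n n \<Longrightarrow> leading_block n A = A"
  by (intro eq_matI) auto

lemma trailing_block_dim: "A \<in> carrier_mat n n \<Longrightarrow> trailing_block n A = A"
  by (intro eq_matI) (auto simp: trailing_block_def)

text \<open>\<open>pick\<close> enumerates an index set increasingly, so \<open>pick I\<close> at
  the number of members of \<open>I\<close> below \<open>x\<close> returns \<open>x\<close> for each
  \<open>x\<close> in \<open>I\<close>. Counting these members shows that \<open>pick\<close> is the
  identity here and a shift by \<open>n - k\<close> for trailing minors.\<close>

lemma leading_minor_eq:
  assumes "A \<in> carrier_mat n n" "k \<le> n"
  shows "leading_minor A k = det (leading_block k A)"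
proof -
  have "{i. i < n \<and> i \<in> {..<k}} = {..<k}"
    using assms(2) by auto
  moreover have "pick {..<k} i = i" if "i < k" for i
  proof -
    have "{a \<in> {..<k}. a < i} = {..<i}"
      using that by auto
    then show ?thesis
      using pick_card_in_set[of i "{..<k}"] that by simp
  qed
  ultimately have "submatrix A {..<k} {..<k} = leading_block k A"
    using assms unfolding submatrix_def by (intro eq_matI) auto
  then show ?thesis
    by (simp add: leading_minor_def)
qed

lemma trailing_minor_eq:
  assumes "A \<in> carrier_mat n n" "k \<le> n"
  shows "trailing_minor A k = det (trailing_block k A)"
proof -
  let ?I = "{n - k..<n}"
  have "{i. i < n \<and> i \<in> ?I} = ?I"
    by auto
  moreover have "pick ?I i = n - k + i" if "i < k" for i
  proof -
    have "{a \<in> ?I. a < n - k + i} = {n - k..<n - k + i}"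
      using that assms(2) by auto
    moreover have "pick ?I (card {a \<in> ?I. a < n - k + i}) = n - k + i"
      using that assms(2) by (intro pick_card_in_set) auto
    ultimately show ?thesis
      by simp
  qed
  ultimately have "submatrix A ?I ?I = trailing_block k A"
    using assms unfolding submatrix_def trailing_block_def by (intro eq_matI) auto
  then show ?thesis
    using assms(1) by (simp add: trailing_minor_def)
qed

section \<open>Block decompositions and congruence by lower triangular matrices\<close>

lemma leading_block_four_block:
  assumes "A \<in> carrier_mat k k" "D \<in> carrier_mat m m"
  shows "leading_block k (four_block_mat A B C D) = A"
  using assms by (intro eq_matI) auto

lemma leading_block_leading_block:
  "k \<le> m \<Longrightarrow> leading_block k (leading_block m A) = leading_block k A"
  by (intro eq_matI) auto

lemma four_block_decomposition:
  assumes "A \<in> carrier_mat (k + m) (k + m)"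
  obtains B C D where "B \<in> carrier_mat k m" "C \<in> carrier_mat m k" "D \<in> carrier_mat m m"
    "A = four_block_mat (leading_block k A) B C D" "trailing_block m A = D"
proof
  show "A = four_block_mat (leading_block k A) (mat k m (\<lambda>(i, j). A $$ (i, j + k)))
      (mat m k (\<lambda>(i, j). A $$ (i + k, j))) (trailing_block m A)"
    using assms by (intro eq_matI) (auto simp: trailing_block_def)
qed (auto simp: trailing_block_def)

lemma lower_triangular_decomposition:
  assumes "L \<in> carrier_mat (k + m) (k + m)" "lower_triangular L"
  obtains C D where "C \<in> carrier_mat m k" "D \<in> carrier_mat m m"
    "L = four_block_mat (leading_block k L) (0\<^sub>m k m) C D" "trailing_block m L = D"
proof -
  obtain B C D where *: "B \<in> carrier_mat k m" "C \<in> carrier_mat m k" "D \<in> carrier_mat m m"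
    "L = four_block_mat (leading_block k L) B C D" "trailing_block m L = D"
    using four_block_decomposition[OF assms(1)] by blast
  have "B = 0\<^sub>m k m"
  proof (rule eq_matI)
    fix i j assume ij: "i < dim_row (0\<^sub>m k m)" "j < dim_col (0\<^sub>m k m)"
    then have "B $$ (i, j) = L $$ (i, k + j)"
      using *(1-3) arg_cong[OF *(4), of "\<lambda>M. M $$ (i, k + j)"] by simp
    also have "\<dots> = 0"
      using assms ij by (auto simp: lower_triangular_def)
    finally show "B $$ (i, j) = 0\<^sub>m k m $$ (i, j)"
      using ij by simp
  qed (use *(1) in auto)
  with * show ?thesis
    using that by metis
qed

lemma det_lower_triangular_blocks:
  fixes L :: "'a :: field mat"
  assumes "L \<in> carrier_mat (k + m) (k + m)" "lower_triangular L"
  shows "det L = det (leading_block k L) * det (trailing_block m L)"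
proof -
  obtain C D where *: "C \<in> carrier_mat m k" "D \<in> carrier_mat m m"
    "L = four_block_mat (leading_block k L) (0\<^sub>m k m) C D" "trailing_block m L = D"
    using lower_triangular_decomposition[OF assms] by blast
  show ?thesis
    unfolding *(4) by (subst *(3), rule det_four_block_mat_upper_right_zero) (use * in auto)
qed

lemma lower_triangular_leading_block:
  "L \<in> carrier_mat n n \<Longrightarrow> k \<le> n \<Longrightarrow> lower_triangular L \<Longrightarrow> lower_triangular (leading_block k L)"
  by (auto simp: lower_triangular_def)

lemma symmetric_leading_block:
  assumes "A \<in> carrier_mat n n" "k \<le> n" "symmetric_mat A"
  shows "symmetric_mat (leading_block k A)"
proof -
  have "A $$ (j, i) = A $$ (i, j)" if "i < n" "j < n" for i j
    using assms that by (metis symmetric_mat_def index_transpose_mat(1) carrier_matD)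
  then show ?thesis
    using assms(2) unfolding symmetric_mat_def by (intro eq_matI) auto
qed

lemma symmetric_congruence:
  assumes "A \<in> carrier_mat n n" "L \<in> carrier_mat n n" "symmetric_mat (A :: 'a :: comm_ring_1 mat)"
  shows "symmetric_mat (L * A * L\<^sup>T)"
proof -
  have "(L * A * L\<^sup>T)\<^sup>T = L\<^sup>T\<^sup>T * (A\<^sup>T * L\<^sup>T)"
    using assms by (simp add: transpose_mult[of _ n n _ n])
  also have "\<dots> = L * A * L\<^sup>T"
    using assms by (simp add: symmetric_mat_def assoc_mult_mat[of _ n n _ n _ n])
  finally show ?thesis
    by (simp add: symmetric_mat_def)
qed

text \<open>Block multiplication, where the zero block of \<open>L\<close> keeps \<open>C\<close>
  and \<open>D\<close> out of the upper left corner. The lower blocks \<open>X\<close> and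
  \<open>Y\<close> stay anonymous: in the symmetric case with \<open>m = 1\<close> and a regular
  leading block, \<open>symmetric_mat_eqI\<close> recovers them from the upper half and the
  determinant.\<close>

lemma blocks_lower_triangular_congruence:
  fixes A L :: "'a :: comm_ring_1 mat"
  assumes L: "L \<in> carrier_mat (k + m) (k + m)" "lower_triangular L"
    and A: "A \<in> carrier_mat (k + m) (k + m)"
    and LC: "L = four_block_mat (leading_block k L) (0\<^sub>m k m) C D"
      "C \<in> carrier_mat m k" "D \<in> carrier_mat m m"
    and AB: "A = four_block_mat (leading_block k A) B B' E"
      "B \<in> carrier_mat k m" "B' \<in> carrier_mat m k" "E \<in> carrier_mat m m"
  obtains X Y where "X \<in> carrier_mat m k" "Y \<in> carrier_mat m m"
    "L * A * L\<^sup>T = four_block_mat (leading_block k L * leading_block k A * (leading_block k L)\<^sup>T)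
      (leading_block k L * leading_block k A * C\<^sup>T + leading_block k L * B * D\<^sup>T) X Y"
proof -
  define L1 where "L1 = leading_block k L"
  define A1 where "A1 = leading_block k A"
  have c: "L1 \<in> carrier_mat k k" "A1 \<in> carrier_mat k k"
    by (auto simp: L1_def A1_def)
  have L_eq: "L = four_block_mat L1 (0\<^sub>m k m) C D" and A_eq: "A = four_block_mat A1 B B' E"
    using LC(1) AB(1) by (simp_all add: L1_def A1_def)
  have LT: "L\<^sup>T = four_block_mat L1\<^sup>T C\<^sup>T (0\<^sub>m m k) D\<^sup>T"
    unfolding L_eq using c LC(2,3) by (subst transpose_four_block_mat[of _ k k _ m _ m]) auto
  have "L * A = four_block_mat (L1 * A1) (L1 * B) (C * A1 + D * B') (C * B + D * E)"
    unfolding L_eq A_eq using c LC(2,3) AB(2,3,4)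
    by (subst mult_four_block_mat[of _ k k _ m _ m _ _ k _ m]) auto
  then have "L * A * L\<^sup>T = four_block_mat (L1 * A1 * L1\<^sup>T) (L1 * A1 * C\<^sup>T + L1 * B * D\<^sup>T)
      ((C * A1 + D * B') * L1\<^sup>T) ((C * A1 + D * B') * C\<^sup>T + (C * B + D * E) * D\<^sup>T)"
    unfolding LT using c LC(2,3) AB(2,3,4)
    by (simp add: mult_four_block_mat[of _ k k _ m _ m _ _ k _ m]) auto
  moreover have "(C * A1 + D * B') * L1\<^sup>T \<in> carrier_mat m k"
    "(C * A1 + D * B') * C\<^sup>T + (C * B + D * E) * D\<^sup>T \<in> carrier_mat m m"
    using c LC(2,3) AB(2,3,4) by auto
  ultimately show ?thesis
    using that unfolding L1_def A1_def by blast
qed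

lemma leading_block_lower_triangular_congruence:
  fixes A L :: "'a :: comm_ring_1 mat"
  assumes L: "L \<in> carrier_mat n n" "lower_triangular L" and A: "A \<in> carrier_mat n n" and k: "k \<le> n"
  shows "leading_block k (L * A * L\<^sup>T) =
    leading_block k L * leading_block k A * (leading_block k L)\<^sup>T"
proof -
  from k obtain m where n: "n = k + m"
    by (auto simp: le_iff_add)
  obtain C D where LC: "C \<in> carrier_mat m k" "D \<in> carrier_mat m m"
    "L = four_block_mat (leading_block k L) (0\<^sub>m k m) C D"
    using lower_triangular_decomposition[OF L[unfolded n]] by metis
  obtain B B' E where AB: "B \<in> carrier_mat k m" "B' \<in> carrier_mat m k" "E \<in> carrier_mat m m"
    "A = four_block_mat (leading_block k A) B B' E"
    using four_block_decomposition[OF A[unfolded n]] by metis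
  obtain X Y where "X \<in> carrier_mat m k" and Y: "Y \<in> carrier_mat m m" and
    eq: "L * A * L\<^sup>T = four_block_mat (leading_block k L * leading_block k A * (leading_block k L)\<^sup>T)
      (leading_block k L * leading_block k A * C\<^sup>T + leading_block k L * B * D\<^sup>T) X Y"
    using blocks_lower_triangular_congruence[OF L[unfolded n] A[unfolded n] LC(3,1,2) AB(4,1,2,3)]
    by blast
  show ?thesis
    unfolding eq by (rule leading_block_four_block[OF _ Y]) auto
qed

section \<open>Splitting off the last row and column\<close>

text \<open>The corner entry is left out, and the result is a one-column matrix and not a vector, so
  that it can serve as a block of \<open>four_block_mat\<close>.\<close>

definition last_column :: "'a mat \<Rightarrow> 'a mat" where
  "last_column A = mat (dim_row A - 1) 1 (\<lambda>(i, _). A $$ (i, dim_col A - 1))"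

text \<open>The last row without its corner, stood upright as a column: it will be the unknown of a
  linear system.\<close>

definition last_row_t :: "'a mat \<Rightarrow> 'a mat" where
  "last_row_t A = last_column A\<^sup>T"

lemma lower_triangular_last_decomposition:
  fixes L :: "'a :: comm_ring_1 mat"
  assumes "L \<in> carrier_mat (Suc n) (Suc n)" "lower_triangular L"
  shows "L = four_block_mat (leading_block n L) (0\<^sub>m n 1) (last_row_t L)\<^sup>T (L $$ (n, n) \<cdot>\<^sub>m 1\<^sub>m 1)"
  using assms
  by (intro eq_matI) (auto simp: last_row_t_def last_column_def lower_triangular_def less_Suc_eq)

lemma last_decomposition:
  fixes A :: "'a :: comm_ring_1 mat"
  assumes "A \<in> carrier_mat (Suc n) (Suc n)"
  shows "A = four_block_mat (leading_block n A) (last_column A) (last_row_t A)\<^sup>T (A $$ (n, n) \<cdot>\<^sub>m 1\<^sub>m 1)"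
  using assms
  by (intro eq_matI) (auto simp: last_row_t_def last_column_def less_Suc_eq)

text \<open>The block formula for \<open>m = 1\<close>. Once the leading block and the corner of
  \<open>L\<close> are fixed, the last column of the product is affine in the last row of
  \<open>L\<close>, with linear part \<open>leading_block n L * leading_block n A\<close>.\<close>

lemma last_column_lower_triangular_congruence:
  fixes A L :: "'a :: comm_ring_1 mat"
  assumes L: "L \<in> carrier_mat (Suc n) (Suc n)" "lower_triangular L"
    and A: "A \<in> carrier_mat (Suc n) (Suc n)"
  shows "last_column (L * A * L\<^sup>T) = leading_block n L * leading_block n A * last_row_t L
      + L $$ (n, n) \<cdot>\<^sub>m (leading_block n L * last_column A)"
proof -
  have c: "last_row_t L \<in> carrier_mat n 1" "last_column A \<in> carrier_mat n 1" "last_row_t A \<in> carrier_mat n 1"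
    using L A by (auto simp: last_row_t_def last_column_def)
  let ?D = "L $$ (n, n) \<cdot>\<^sub>m 1\<^sub>m 1"
  let ?R = "leading_block n L * leading_block n A * (last_row_t L)\<^sup>T\<^sup>T + leading_block n L * last_column A * ?D\<^sup>T"
  obtain X Y where X: "X \<in> carrier_mat 1 n" and Y: "Y \<in> carrier_mat 1 1" and
    eq: "L * A * L\<^sup>T = four_block_mat (leading_block n L * leading_block n A * (leading_block n L)\<^sup>T) ?R X Y"
  proof (rule blocks_lower_triangular_congruence[of L n 1 A])
    show "L = four_block_mat (leading_block n L) (0\<^sub>m n 1) (last_row_t L)\<^sup>T ?D"
      by (rule lower_triangular_last_decomposition[OF L])
    show "A = four_block_mat (leading_block n A) (last_column A) (last_row_t A)\<^sup>T
        (A $$ (n, n) \<cdot>\<^sub>m 1\<^sub>m 1)"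
      by (rule last_decomposition[OF A])
  qed (use L A c in auto)
  have "last_column (L * A * L\<^sup>T) = ?R"
    unfolding eq using X Y c by (intro eq_matI) (auto simp: last_column_def)
  also have "?D\<^sup>T = ?D"
    by (intro eq_matI) auto
  also have "leading_block n L * last_column A * ?D = L $$ (n, n) \<cdot>\<^sub>m (leading_block n L * last_column A)"
    using c by (subst mult_smult_distrib[of _ n 1 _ 1]) auto
  finally show ?thesis
    by simp
qed

text \<open>By symmetry, the block and the last column fix every entry except the corner. Laplace
  expansion along the last row makes the determinant affine in the corner, with the nonzero
  coefficient \<open>det (leading_block n A)\<close>, so equal determinants force equal
  corners.\<close>

lemma symmetric_mat_eqI:
  fixes A B :: "'a :: field mat"
  assumes A: "A \<in> carrier_mat (Suc n) (Suc n)" "symmetric_mat A"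
    and B: "B \<in> carrier_mat (Suc n) (Suc n)" "symmetric_mat B"
    and lead: "leading_block n A = leading_block n B" and col: "last_column A = last_column B"
    and det: "det A = det B" and nz: "det (leading_block n A) \<noteq> 0"
  shows "A = B"
proof -
  have sym: "M $$ (i, j) = M $$ (j, i)"
    if "M \<in> carrier_mat (Suc n) (Suc n)" "symmetric_mat M" "i < Suc n" "j < Suc n" for M :: "'a mat" and i j
    using that by (metis symmetric_mat_def index_transpose_mat(1) carrier_matD)
  have eq: "A $$ (i, j) = B $$ (i, j)" if ij: "i < Suc n" "j < Suc n" "(i, j) \<noteq> (n, n)" for i j
  proof -
    consider "i < n" "j < n" | "i < n" "j = n" | "i = n" "j < n"
      using ij by (auto simp: less_Suc_eq)
    then show ?thesis
    proof cases
      case 1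
      then show ?thesis
        using arg_cong[OF lead, of "\<lambda>M. M $$ (i, j)"] by simp
    next
      case 2
      then show ?thesis
        using arg_cong[OF col, of "\<lambda>M. M $$ (i, 0)"] A B by (simp add: last_column_def)
    next
      case 3
      then have "A $$ (j, i) = B $$ (j, i)"
        using arg_cong[OF col, of "\<lambda>M. M $$ (j, 0)"] A B by (simp add: last_column_def)
      then show ?thesis
        using sym[OF A ij(1,2)] sym[OF B ij(1,2)] by simp
    qed
  qed
  \<comment> \<open>Deleting row \<open>n\<close> removes the one position where the matrices may
    still differ.\<close>
  have cof: "cofactor A n j = cofactor B n j" if "j < Suc n" for j
  proof -
    have "mat_delete A n j = mat_delete B n j"
      using A B by (intro eq_matI) (auto simp: mat_delete_def eq)
    then show ?thesis
      by (simp add: cofactor_def)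
  qed
  have last: "cofactor A n n = det (leading_block n A)"
  proof -
    have "mat_delete A n n = leading_block n A"
      using A by (intro eq_matI) (auto simp: mat_delete_def)
    then show ?thesis
      by (simp add: cofactor_def)
  qed
  have "(\<Sum>j<Suc n. A $$ (n, j) * cofactor A n j) = (\<Sum>j<Suc n. B $$ (n, j) * cofactor B n j)"
    using det laplace_expansion_row[OF A(1), of n] laplace_expansion_row[OF B(1), of n] by simp
  then have "A $$ (n, n) * cofactor A n n = B $$ (n, n) * cofactor A n n"
    using cof eq by simp
  then have "A $$ (n, n) = B $$ (n, n)"
    using nz last by simp
  with eq have "A $$ (i, j) = B $$ (i, j)" if "i < Suc n" "j < Suc n" for i j
    using that by (cases "(i, j) = (n, n)") auto
  then show ?thesis
    using A B by (intro eq_matI) auto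
qed

section \<open>Triangular congruence\<close>

lemma det_lower_triangular_nonzero_iff:
  fixes L :: "'a :: field mat"
  assumes "L \<in> carrier_mat n n" "lower_triangular L"
  shows "det L \<noteq> 0 \<longleftrightarrow> (\<forall>i<n. L $$ (i, i) \<noteq> 0)"
proof -
  have "det L = prod_list (diag_mat L)"
    using assms by (intro det_lower_triangular) (auto simp: lower_triangular_def)
  then show ?thesis
    using assms(1) by (auto simp: prod_list_diag_prod)
qed

lemma lower_triangular_eqI:
  fixes L M :: "'a :: comm_ring_1 mat"
  assumes "L \<in> carrier_mat (Suc n) (Suc n)" "lower_triangular L"
    and "M \<in> carrier_mat (Suc n) (Suc n)" "lower_triangular M"
    and "leading_block n L = leading_block n M" "last_row_t L = last_row_t M"
    and "L $$ (n, n) = M $$ (n, n)"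
  shows "L = M"
  using lower_triangular_last_decomposition[OF assms(1,2)]
    lower_triangular_last_decomposition[OF assms(3,4)] assms(5-7) by metis

lemma det_lower_triangular_Suc:
  fixes L :: "'a :: field mat"
  assumes "L \<in> carrier_mat (Suc n) (Suc n)" "lower_triangular L"
  shows "det L = det (leading_block n L) * L $$ (n, n)"
proof -
  have "det (trailing_block 1 L) = L $$ (n, n)"
    using assms(1) by (subst det_single) (auto simp: trailing_block_def)
  then show ?thesis
    using det_lower_triangular_blocks[of L n 1] assms by simp
qed

lemma det_congruence:
  fixes L A :: "'a :: comm_ring_1 mat"
  assumes "L \<in> carrier_mat n n" "A \<in> carrier_mat n n"
  shows "det (L * A * L\<^sup>T) = det L ^ 2 * det A"
  using assms by (simp add: det_mult[of _ n] det_transpose[of _ n] power2_eq_square)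

lemma obtain_inverse_mat:
  fixes M :: "'a :: field mat"
  assumes "M \<in> carrier_mat n n" "det M \<noteq> 0"
  obtains N where "N \<in> carrier_mat n n" "N * M = 1\<^sub>m n" "M * N = 1\<^sub>m n"
  \<comment> \<open>The argument \<open>()\<close> fills the extension slot of the record
    \<open>ring_mat\<close>, whose units are the regular matrices.\<close>
  using det_non_zero_imp_unit[OF assms, of "()"] by (auto simp: Units_def ring_mat_def)

text \<open>Induction on the size: the leading block of \<open>L\<close> is given by the induction hypothesis,
  comparing determinants fixes the square of the last diagonal entry, and comparing the last
  columns gives a regular linear system for the rest of the last row. The corner entry of the
  equation then comes for free, because it is determined by the determinant.\<close>

theorem ex1_lower_triangular_congruence:
  fixes A B :: "'a :: field mat"
  assumes sqrt: "\<And>c :: 'a. positive_elem c \<Longrightarrow> \<exists>!y. positive_elem y \<and> y ^ 2 = c"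
    and "A \<in> carrier_mat n n" "symmetric_mat A" "B \<in> carrier_mat n n" "symmetric_mat B"
    and "\<And>k. k \<in> {1..n} \<Longrightarrow> positive_elem (det (leading_block k A) / det (leading_block k B))"
  shows "\<exists>!L. L \<in> carrier_mat n n \<and> lower_triangular L \<and>
    (\<forall>i<n. positive_elem (L $$ (i, i))) \<and> A = L * B * L\<^sup>T"
  using assms(2-)
proof (induction n arbitrary: A B)
  case 0
  \<comment> \<open>All 0 by 0 matrices coincide, so \<open>A\<close> itself can play the role of
    \<open>L\<close>.\<close>
  then show ?case
    by (intro ex1I[of _ A]) (auto simp: lower_triangular_def)
next
  case (Suc n)
  let ?A1 = "leading_block n A" and ?B1 = "leading_block n B"
  note A = Suc.prems(1,2) and B = Suc.prems(3,4) and ratio = Suc.prems(5)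
  have A1: "?A1 \<in> carrier_mat n n" "symmetric_mat ?A1"
    and B1: "?B1 \<in> carrier_mat n n" "symmetric_mat ?B1"
    using symmetric_leading_block[of A "Suc n" n] symmetric_leading_block[of B "Suc n" n] A B by auto
  define P where "P L \<longleftrightarrow> L \<in> carrier_mat n n \<and> lower_triangular L \<and>
    (\<forall>i<n. positive_elem (L $$ (i, i))) \<and> ?A1 = L * ?B1 * L\<^sup>T" for L
  have "\<exists>!L. P L"
    unfolding P_def using ratio by (intro Suc.IH A1 B1) (simp add: leading_block_leading_block)
  then obtain L1 where "P L1" and L1_unique: "\<And>M. P M \<Longrightarrow> M = L1"
    by blast
  then have L1: "L1 \<in> carrier_mat n n" "lower_triangular L1" "\<forall>i<n. positive_elem (L1 $$ (i, i))"
      "?A1 = L1 * ?B1 * L1\<^sup>T"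
    unfolding P_def by blast+
  \<comment> \<open>Since division by zero gives 0, which is not positive, a positive ratio already
    makes both minors nonzero; the empty minor is 1.\<close>
  have nz: "det (leading_block k A) \<noteq> 0 \<and> det (leading_block k B) \<noteq> 0" if "k \<le> Suc n" for k
    using ratio[of k] that by (cases "k = 0") (auto dest: positive_elem_nonzero)
  have det_AB: "det A \<noteq> 0" "det B \<noteq> 0"
    using nz[of "Suc n"] A B by (simp_all add: leading_block_dim)
  have det_L1: "det L1 \<noteq> 0"
    using L1 det_lower_triangular_nonzero_iff positive_elem_nonzero by blast
  have M: "L1 * ?B1 \<in> carrier_mat n n" "det (L1 * ?B1) \<noteq> 0"
    using L1(1) det_L1 nz[of n] by (simp_all add: det_mult[of _ n])
  then obtain N where N: "N \<in> carrier_mat n n" "N * (L1 * ?B1) = 1\<^sub>m n" "(L1 * ?B1) * N = 1\<^sub>m n"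
    using obtain_inverse_mat by blast
  \<comment> \<open>The solution for \<open>\<mu> ^ 2\<close> of
    \<open>det A = (det L1 * \<mu>) ^ 2 * det B\<close>.\<close>
  define c where "c = det A / det B / det L1 ^ 2"
  have "positive_elem c"
    using ratio[of "Suc n"] A(1) B(1) positive_elem_square[OF det_L1] unfolding c_def
    by (intro positive_elem_divide[of "det A / det B"]) (simp_all add: leading_block_dim)
  then obtain \<mu> where \<mu>: "positive_elem \<mu>" "\<mu> ^ 2 = c"
    and \<mu>_unique: "\<And>y. positive_elem y \<Longrightarrow> y ^ 2 = c \<Longrightarrow> y = \<mu>"
    using sqrt[OF \<open>positive_elem c\<close>] by (metis (no_types))
  \<comment> \<open>The last row \<open>x\<close> of \<open>L\<close> has to satisfy
    \<open>L1 * ?B1 * x = r\<close>, and \<open>N\<close> inverts the coefficient matrix.\<close>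
  define r where "r = last_column A - \<mu> \<cdot>\<^sub>m (L1 * last_column B)"
  have col: "last_column A \<in> carrier_mat n 1" "last_column B \<in> carrier_mat n 1"
    using A B by (auto simp: last_column_def)
  then have r: "r \<in> carrier_mat n 1"
    using L1(1) by (auto simp: r_def)
  define L where "L = four_block_mat L1 (0\<^sub>m n 1) (N * r)\<^sup>T (\<mu> \<cdot>\<^sub>m 1\<^sub>m 1)"
  have L: "L \<in> carrier_mat (Suc n) (Suc n)" "lower_triangular L"
    using L1(1,2) N(1) r by (auto simp: L_def lower_triangular_def)
  have L_blocks: "leading_block n L = L1" "last_row_t L = N * r" "L $$ (n, n) = \<mu>"
  proof -
    show "leading_block n L = L1"
      unfolding L_def using L1(1) by (intro leading_block_four_block[of _ _ _ 1]) auto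
    show "last_row_t L = N * r"
      using L1(1) N(1) r by (intro eq_matI) (auto simp: L_def last_row_t_def last_column_def)
    show "L $$ (n, n) = \<mu>"
      using L1(1) by (simp add: L_def)
  qed
  have cong: "symmetric_mat (M * B * M\<^sup>T)" "M * B * M\<^sup>T \<in> carrier_mat (Suc n) (Suc n)"
    if "M \<in> carrier_mat (Suc n) (Suc n)" for M
    using symmetric_congruence[OF B(1) that B(2)] that B(1) by auto
  show ?case
  proof (rule ex1I[of _ L], intro conjI allI impI)
    show "positive_elem (L $$ (i, i))" if "i < Suc n" for i
      using that L1(1,3) L_blocks(3) \<mu>(1) by (cases "i = n") (auto simp: L_def)
    show "A = L * B * L\<^sup>T"
    proof (rule symmetric_mat_eqI[OF A cong(2,1)[OF L(1)]])
      show "?A1 = leading_block n (L * B * L\<^sup>T)"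
        using leading_block_lower_triangular_congruence[OF L B(1), of n] L1(4) L_blocks(1) by simp
      have "L1 * ?B1 * (N * r) = r"
        using M(1) N r by (simp flip: assoc_mult_mat[of _ n n _ n _ 1])
      then have "last_column (L * B * L\<^sup>T) = r + \<mu> \<cdot>\<^sub>m (L1 * last_column B)"
        using last_column_lower_triangular_congruence[OF L B(1)] L_blocks by simp
      then show "last_column A = last_column (L * B * L\<^sup>T)"
        using col L1(1) by (auto simp: r_def intro!: eq_matI)
      have "det L ^ 2 * det B = det A"
        using det_lower_triangular_Suc[OF L] L_blocks \<mu>(2) det_L1 det_AB
        by (simp add: c_def power_mult_distrib)
      then show "det A = det (L * B * L\<^sup>T)"
        using det_congruence[OF L(1) B(1)] by simp
      show "det ?A1 \<noteq> 0"
        using nz[of n] by simp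
    qed
  next
    fix K assume "K \<in> carrier_mat (Suc n) (Suc n) \<and> lower_triangular K \<and>
      (\<forall>i<Suc n. positive_elem (K $$ (i, i))) \<and> A = K * B * K\<^sup>T"
    then have K: "K \<in> carrier_mat (Suc n) (Suc n)" "lower_triangular K"
      and K_pos: "\<And>i. i < Suc n \<Longrightarrow> positive_elem (K $$ (i, i))" and A_eq: "A = K * B * K\<^sup>T"
      by auto
    have "?A1 = leading_block n (K * B * K\<^sup>T)"
      using A_eq by simp
    then have K1: "leading_block n K = L1"
      using K_pos leading_block_lower_triangular_congruence[OF K B(1), of n]
        lower_triangular_leading_block[OF K(1) _ K(2), of n]
      by (intro L1_unique) (auto simp: P_def)
    have "det A = (det L1 * K $$ (n, n)) ^ 2 * det B"
      using det_congruence[OF K(1) B(1)] det_lower_triangular_Suc[OF K] K1 A_eq by simp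
    then have "(K $$ (n, n)) ^ 2 = c"
      using det_L1 det_AB by (simp add: c_def field_simps)
    then have Kn: "K $$ (n, n) = \<mu>"
      using \<mu>_unique K_pos by simp
    have row: "last_row_t K \<in> carrier_mat n 1"
      using K by (auto simp: last_row_t_def last_column_def)
    have "last_column A = L1 * ?B1 * last_row_t K + \<mu> \<cdot>\<^sub>m (L1 * last_column B)"
      using last_column_lower_triangular_congruence[OF K B(1)] K1 Kn A_eq by simp
    then have "r = L1 * ?B1 * last_row_t K"
      using row col L1(1) M(1) by (auto simp: r_def intro!: eq_matI)
    then have "N * r = N * (L1 * ?B1) * last_row_t K"
      using N(1) M(1) row by (simp add: assoc_mult_mat[of N n n "L1 * ?B1" n _ 1])
    then have "last_row_t K = N * r"
      using N(2) row by simp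
    then show "K = L"
      using K1 Kn L_blocks by (intro lower_triangular_eqI[OF K L]) auto
  qed (fact L)+
qed

section \<open>Triangular congruence on matrices with prescribed leading signs\<close>

lemma LPM_iff:
  "A \<in> LPM n \<epsilon> \<longleftrightarrow> A \<in> carrier_mat n n \<and> symmetric_mat A \<and>
    (\<forall>k\<in>{1..n}. has_sign (\<epsilon> k) (det (leading_block k A)))"
  by (auto simp: LPM_def LPM_all_def has_sign_def leading_minor_eq)

lemma TPM_iff:
  "A \<in> TPM n \<epsilon> \<longleftrightarrow> A \<in> carrier_mat n n \<and> symmetric_mat A \<and>
    (\<forall>k\<in>{1..n}. has_sign (\<epsilon> k) (det (trailing_block k A)))"
  by (auto simp: TPM_def TPM_all_def has_sign_def trailing_minor_eq)

lemma invertible_mat_det_nonzero: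
  fixes L :: "'a :: field mat"
  assumes "L \<in> carrier_mat n n" "invertible_mat L"
  shows "det L \<noteq> 0"
proof -
  from assms obtain B where B: "L * B = 1\<^sub>m n" "B * L = 1\<^sub>m (dim_row B)"
    by (auto simp: invertible_mat_def inverts_mat_def)
  \<comment> \<open>\<open>invertible_mat\<close> does not prescribe the format of the inverse; it
    is read off from the column dimensions of the two products.\<close>
  have "B \<in> carrier_mat n n"
    using arg_cong[OF B(1), of dim_col] arg_cong[OF B(2), of dim_col] assms(1) by auto
  then have "det L * det B = 1"
    using det_mult[OF assms(1)] B(1) by (metis det_one)
  then show ?thesis
    by auto
qed

text \<open>A regular triangular matrix has a nonzero diagonal, which each leading block inherits.
  Hence the factor \<open>det (leading_block k L) ^ 2\<close> is the square of a nonzero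
  element.\<close>

lemma LPM_lower_triangular_congruence:
  assumes A: "A \<in> LPM n \<epsilon>"
    and L: "L \<in> carrier_mat n n" "lower_triangular L" "invertible_mat L"
  shows "L * A * L\<^sup>T \<in> LPM n \<epsilon>"
proof -
  have A': "A \<in> carrier_mat n n" "symmetric_mat A"
    and sgn: "\<And>k. k \<in> {1..n} \<Longrightarrow> has_sign (\<epsilon> k) (det (leading_block k A))"
    using A by (auto simp: LPM_iff)
  have "has_sign (\<epsilon> k) (det (leading_block k (L * A * L\<^sup>T)))" if k: "k \<in> {1..n}" for k
  proof -
    have "lower_triangular (leading_block k L)"
      using lower_triangular_leading_block[OF L(1) _ L(2)] k by auto
    moreover have "\<forall>i<n. L $$ (i, i) \<noteq> 0"
      using det_lower_triangular_nonzero_iff[OF L(1,2)] invertible_mat_det_nonzero[OF L(1,3)] by simp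
    ultimately have "det (leading_block k L) \<noteq> 0"
      using det_lower_triangular_nonzero_iff[of "leading_block k L" k] k by auto
    then have "has_sign (\<epsilon> k) (det (leading_block k L) ^ 2 * det (leading_block k A))"
      by (intro has_sign_square_mult sgn k)
    then show ?thesis
      using k leading_block_lower_triangular_congruence[OF L(1,2) A'(1), of k]
      by (simp add: det_congruence[of _ k])
  qed
  then show ?thesis
    using symmetric_congruence[OF A'(1) L(1) A'(2)] A'(1) L(1) by (auto simp: LPM_iff)
qed

lemma LPM_ex1_lower_triangular_congruence:
  fixes A B :: "'a :: {field, finite} mat"
  assumes F: "definite_field TYPE('a) \<or> CHAR('a) = 2" and \<epsilon>: "sign_pattern n \<epsilon>"
    and A: "A \<in> LPM n \<epsilon>" and B: "B \<in> LPM n \<epsilon>"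
  shows "\<exists>!L. L \<in> carrier_mat n n \<and> lower_triangular L \<and>
    (\<forall>i<n. positive_elem (L $$ (i, i))) \<and> A = L * B * L\<^sup>T"
proof (rule ex1_lower_triangular_congruence)
  fix k assume k: "k \<in> {1..n}"
  then have "\<epsilon> k \<in> {1, - 1}"
    using \<epsilon> by (auto simp: sign_pattern_def)
  then show "positive_elem (det (leading_block k A) / det (leading_block k B))"
    using A B k by (intro has_sign_imp_positive_ratio[OF F]) (auto simp: LPM_iff)
qed (use A B ex1_positive_sqrt[OF F] in \<open>auto simp: LPM_iff\<close>)

section \<open>Conjugation by the anti-diagonal matrix\<close>

lemma nabla_mat_carrier [simp]: "nabla_mat n \<in> carrier_mat n n"
  by (simp add: nabla_mat_def)

lemma nabla_mat_dim [simp]: "dim_row (nabla_mat n) = n" "dim_col (nabla_mat n) = n"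
  by (simp_all add: nabla_mat_def)

lemma nabla_mat_mult:
  fixes A :: "'a :: comm_ring_1 mat"
  assumes "A \<in> carrier_mat n m" "i < n" "j < m"
  shows "(nabla_mat n * A) $$ (i, j) = A $$ (n - 1 - i, j)"
proof -
  have "(nabla_mat n * A) $$ (i, j) = (\<Sum>k<n. (if i + k + 1 = n then 1 else 0) * A $$ (k, j))"
    using assms by (simp add: nabla_mat_def scalar_prod_def lessThan_atLeast0)
  also have "\<dots> = (\<Sum>k<n. if k = n - 1 - i then A $$ (k, j) else 0)"
    using assms(2) by (intro sum.cong) auto
  also have "\<dots> = A $$ (n - 1 - i, j)"
    using assms(2) by simp
  finally show ?thesis .
qed

lemma mult_nabla_mat:
  fixes A :: "'a :: comm_ring_1 mat"
  assumes "A \<in> carrier_mat m n" "i < m" "j < n"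
  shows "(A * nabla_mat n) $$ (i, j) = A $$ (i, n - 1 - j)"
proof -
  have "(A * nabla_mat n) $$ (i, j) = (\<Sum>k<n. A $$ (i, k) * (if k + j + 1 = n then 1 else 0))"
    using assms by (simp add: nabla_mat_def scalar_prod_def lessThan_atLeast0)
  also have "\<dots> = (\<Sum>k<n. if k = n - 1 - j then A $$ (i, k) else 0)"
    using assms(3) by (intro sum.cong) auto
  also have "\<dots> = A $$ (i, n - 1 - j)"
    using assms(3) by simp
  finally show ?thesis .
qed

lemma nabla_mat_squared: "nabla_mat n * nabla_mat n = (1\<^sub>m n :: 'a :: comm_ring_1 mat)"
proof (rule eq_matI)
  fix i j assume "i < dim_row (1\<^sub>m n)" "j < dim_col (1\<^sub>m n)"
  then show "(nabla_mat n * nabla_mat n) $$ (i, j) = (1\<^sub>m n :: 'a mat) $$ (i, j)"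
    by (subst nabla_mat_mult[of _ n n]) (auto simp: nabla_mat_def)
qed auto

text \<open>Because \<open>nabla_mat n\<close> is its own inverse, this is an involutive ring
  automorphism of the square matrices of size \<open>n\<close>, and it commutes with transposition.
  Congruences are therefore mapped to congruences.\<close>

definition nabla_conj :: "nat \<Rightarrow> 'a :: comm_ring_1 mat \<Rightarrow> 'a mat" where
  "nabla_conj n A = nabla_mat n * A * nabla_mat n"

lemma nabla_conj_carrier [simp]: "A \<in> carrier_mat n n \<Longrightarrow> nabla_conj n A \<in> carrier_mat n n"
  by (simp add: nabla_conj_def mult_carrier_mat[of _ n n _ n])

lemma nabla_conj_dim [simp]: "dim_row (nabla_conj n A) = n" "dim_col (nabla_conj n A) = n"
  by (simp_all add: nabla_conj_def)

lemma nabla_conj_index: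
  assumes "A \<in> carrier_mat n n" "i < n" "j < n"
  shows "nabla_conj n A $$ (i, j) = A $$ (n - 1 - i, n - 1 - j)"
proof -
  have "nabla_conj n A $$ (i, j) = (nabla_mat n * A) $$ (i, n - 1 - j)"
    unfolding nabla_conj_def using assms by (intro mult_nabla_mat[of _ n]) (auto intro!: mult_carrier_mat)
  also have "\<dots> = A $$ (n - 1 - i, n - 1 - j)"
    using assms by (intro nabla_mat_mult[of _ n n]) auto
  finally show ?thesis .
qed

lemma nabla_conj_nabla_conj: "A \<in> carrier_mat n n \<Longrightarrow> nabla_conj n (nabla_conj n A) = A"
  by (intro eq_matI) (auto simp: nabla_conj_index)

lemma nabla_conj_mult:
  assumes "A \<in> carrier_mat n n" "B \<in> carrier_mat n n"
  shows "nabla_conj n (A * B) = nabla_conj n A * nabla_conj n B"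
proof -
  let ?N = "nabla_mat n"
  have "nabla_conj n A * nabla_conj n B = ?N * A * (?N * ?N) * (B * ?N)"
    using assms by (simp add: nabla_conj_def assoc_mult_mat[of _ n n _ n _ n] mult_carrier_mat[of _ n n _ n])
  also have "\<dots> = nabla_conj n (A * B)"
    using assms by (simp add: nabla_conj_def nabla_mat_squared assoc_mult_mat[of _ n n _ n _ n]
        mult_carrier_mat[of _ n n _ n])
  finally show ?thesis ..
qed

lemma transpose_nabla_conj:
  "A \<in> carrier_mat n n \<Longrightarrow> (nabla_conj n A)\<^sup>T = nabla_conj n A\<^sup>T"
  by (intro eq_matI) (auto simp: nabla_conj_index)

lemma nabla_conj_congruence:
  assumes "A \<in> carrier_mat n n" "L \<in> carrier_mat n n"
  shows "nabla_conj n (L * A * L\<^sup>T) = nabla_conj n L * nabla_conj n A * (nabla_conj n L)\<^sup>T"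
  using nabla_conj_mult[of "L * A" n "L\<^sup>T"] nabla_conj_mult[of L n A] transpose_nabla_conj[of L n] assms
  by simp

lemma symmetric_mat_nabla_conj:
  "A \<in> carrier_mat n n \<Longrightarrow> symmetric_mat A \<Longrightarrow> symmetric_mat (nabla_conj n A)"
  by (simp add: symmetric_mat_def transpose_nabla_conj)

text \<open>The sign of the reversing permutation enters squared, so it never has to be
  computed.\<close>

lemma det_nabla_conj:
  assumes "A \<in> carrier_mat n n"
  shows "det (nabla_conj n A) = det A"
proof -
  let ?N = "nabla_mat n :: 'a mat"
  have "det ?N * det ?N = 1"
    by (subst det_mult[of _ n, symmetric]) (auto simp: nabla_mat_squared)
  moreover have "det (nabla_conj n A) = det ?N * det ?N * det A"
    using assms by (simp add: nabla_conj_def det_mult[of _ n] mult_carrier_mat[of _ n n _ n] ac_simps)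
  ultimately show ?thesis
    by simp
qed

text \<open>Reversing all \<open>n\<close> indices maps the last \<open>k\<close> of them onto the
  first \<open>k\<close>, again in reversed order.\<close>

lemma trailing_block_nabla_conj:
  assumes "A \<in> carrier_mat n n" "k \<le> n"
  shows "trailing_block k (nabla_conj n A) = nabla_conj k (leading_block k A)"
  using assms by (intro eq_matI) (auto simp: trailing_block_def nabla_conj_index)

section \<open>Transfer from leading to trailing minors\<close>

lemma TPM_nabla_conj_iff:
  fixes A :: "'a :: {field, finite} mat"
  assumes A: "A \<in> carrier_mat n n"
  shows "nabla_conj n A \<in> TPM n \<epsilon> \<longleftrightarrow> A \<in> LPM n \<epsilon>"
proof -
  have "symmetric_mat (nabla_conj n A) \<longleftrightarrow> symmetric_mat A"
    using symmetric_mat_nabla_conj A nabla_conj_nabla_conj nabla_conj_carrier by metis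
  moreover have "det (trailing_block k (nabla_conj n A)) = det (leading_block k A)" if "k \<in> {1..n}" for k
    using that A by (simp add: trailing_block_nabla_conj det_nabla_conj)
  ultimately show ?thesis
    using A by (simp add: LPM_iff TPM_iff)
qed

lemma LPM_nabla_conj_iff:
  fixes A :: "'a :: {field, finite} mat"
  assumes "A \<in> carrier_mat n n"
  shows "nabla_conj n A \<in> LPM n \<epsilon> \<longleftrightarrow> A \<in> TPM n \<epsilon>"
  using TPM_nabla_conj_iff[of "nabla_conj n A" n \<epsilon>] assms by (simp add: nabla_conj_nabla_conj)

lemma bij_betw_nabla_conj:
  "bij_betw (nabla_conj n) (LPM n \<epsilon>) (TPM n \<epsilon> :: 'a :: {field, finite} mat set)"
proof (rule bij_betw_byWitness[of _ "nabla_conj n"])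
  have carr: "A \<in> LPM n \<epsilon> \<or> A \<in> TPM n \<epsilon> \<Longrightarrow> A \<in> carrier_mat n n" for A :: "'a mat"
    by (auto simp: LPM_iff TPM_iff)
  show "\<forall>A \<in> LPM n \<epsilon> :: 'a mat set. nabla_conj n (nabla_conj n A) = A"
    "\<forall>A \<in> TPM n \<epsilon> :: 'a mat set. nabla_conj n (nabla_conj n A) = A"
    using carr nabla_conj_nabla_conj by blast+
  show "nabla_conj n ` LPM n \<epsilon> \<subseteq> (TPM n \<epsilon> :: 'a mat set)"
    "nabla_conj n ` TPM n \<epsilon> \<subseteq> (LPM n \<epsilon> :: 'a mat set)"
    using carr TPM_nabla_conj_iff LPM_nabla_conj_iff by blast+
qed

lemma upper_triangular_nabla_conj_iff:
  assumes "L \<in> carrier_mat n n"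
  shows "upper_triangular (nabla_conj n L) \<longleftrightarrow> lower_triangular L"
proof
  assume L: "lower_triangular L"
  show "upper_triangular (nabla_conj n L)"
  proof (rule upper_triangularI)
    fix i j assume "j < i" "i < dim_row (nabla_conj n L)"
    then show "nabla_conj n L $$ (i, j) = 0"
      using assms L by (auto simp: nabla_conj_index lower_triangular_def)
  qed
next
  assume U: "upper_triangular (nabla_conj n L)"
  have "L $$ (i, j) = 0" if "i < n" "j < n" "i < j" for i j
  proof -
    have "nabla_conj n L $$ (n - 1 - i, n - 1 - j) = 0"
      using that nabla_conj_carrier[OF assms] by (intro upper_triangularD[OF U]) auto
    then show ?thesis
      using that assms by (simp add: nabla_conj_index)
  qed
  then show "lower_triangular L"
    using assms by (auto simp: lower_triangular_def)
qed

lemma lower_triangular_nabla_conj_iff: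
  "U \<in> carrier_mat n n \<Longrightarrow> lower_triangular (nabla_conj n U) \<longleftrightarrow> upper_triangular U"
  using upper_triangular_nabla_conj_iff[of "nabla_conj n U" n] by (simp add: nabla_conj_nabla_conj)

lemma nabla_conj_diag_iff:
  assumes "L \<in> carrier_mat n n"
  shows "(\<forall>i<n. P (nabla_conj n L $$ (i, i))) \<longleftrightarrow> (\<forall>i<n. P (L $$ (i, i)))"
proof
  assume *: "\<forall>i<n. P (nabla_conj n L $$ (i, i))"
  show "\<forall>i<n. P (L $$ (i, i))"
  proof (intro allI impI)
    fix i assume "i < n"
    then show "P (L $$ (i, i))"
      using *[rule_format, of "n - 1 - i"] assms by (simp add: nabla_conj_index)
  qed
qed (use assms in \<open>auto simp: nabla_conj_index\<close>)

lemma invertible_mat_nabla_conj: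
  assumes U: "U \<in> carrier_mat n n" "invertible_mat (U :: 'a :: field mat)"
  shows "invertible_mat (nabla_conj n U)"
proof -
  obtain V where V: "V \<in> carrier_mat n n" "V * U = 1\<^sub>m n" "U * V = 1\<^sub>m n"
    using obtain_inverse_mat[OF U(1) invertible_mat_det_nonzero[OF U]] by metis
  have one: "nabla_conj n (1\<^sub>m n) = (1\<^sub>m n :: 'a mat)"
    by (simp add: nabla_conj_def nabla_mat_squared)
  have "nabla_conj n U * nabla_conj n V = 1\<^sub>m n" "nabla_conj n V * nabla_conj n U = 1\<^sub>m n"
    using nabla_conj_mult[OF U(1) V(1)] nabla_conj_mult[OF V(1) U(1)] V(2,3) one by simp_all
  then show ?thesis
    using nabla_conj_carrier[OF U(1)] nabla_conj_carrier[OF V(1)]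
    by (auto simp: invertible_mat_def inverts_mat_def)
qed

lemma TPM_upper_triangular_congruence:
  assumes B: "B \<in> TPM n \<epsilon>"
    and U: "U \<in> carrier_mat n n" "upper_triangular U" "invertible_mat U"
  shows "U * B * U\<^sup>T \<in> TPM n \<epsilon>"
proof -
  have carr: "B \<in> carrier_mat n n" "U * B * U\<^sup>T \<in> carrier_mat n n"
    using B U(1) by (auto simp: TPM_iff)
  have "nabla_conj n U * nabla_conj n B * (nabla_conj n U)\<^sup>T \<in> LPM n \<epsilon>"
    using B U carr by (intro LPM_lower_triangular_congruence)
      (simp_all add: LPM_nabla_conj_iff lower_triangular_nabla_conj_iff invertible_mat_nabla_conj)
  then show ?thesis
    using carr U(1) by (simp flip: nabla_conj_congruence add: LPM_nabla_conj_iff)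
qed

text \<open>Conjugation is an injective involution on square matrices that only permutes the
  diagonal. It thus matches the solutions \<open>U\<close> with the solutions \<open>L\<close> of
  the lower triangular problem for the conjugated matrices, and unique existence carries
  over.\<close>

lemma TPM_ex1_upper_triangular_congruence:
  fixes A B :: "'a :: {field, finite} mat"
  assumes F: "definite_field TYPE('a) \<or> CHAR('a) = 2" and \<epsilon>: "sign_pattern n \<epsilon>"
    and A: "A \<in> TPM n \<epsilon>" and B: "B \<in> TPM n \<epsilon>"
  shows "\<exists>!U. U \<in> carrier_mat n n \<and> upper_triangular U \<and>
    (\<forall>i<n. positive_elem (U $$ (i, i))) \<and> A = U * B * U\<^sup>T"
proof -
  define P where "P L \<longleftrightarrow> L \<in> carrier_mat n n \<and> lower_triangular L \<and>
    (\<forall>i<n. positive_elem (L $$ (i, i))) \<and> nabla_conj n A = L * nabla_conj n B * L\<^sup>T" for L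
  define Q where "Q U \<longleftrightarrow> U \<in> carrier_mat n n \<and> upper_triangular U \<and>
    (\<forall>i<n. positive_elem (U $$ (i, i))) \<and> A = U * B * U\<^sup>T" for U
  have carr: "A \<in> carrier_mat n n" "B \<in> carrier_mat n n"
    using A B by (auto simp: TPM_iff)
  have inj: "nabla_conj n X = nabla_conj n Y \<longleftrightarrow> X = Y"
    if "X \<in> carrier_mat n n" "Y \<in> carrier_mat n n" for X Y :: "'a mat"
    using that nabla_conj_nabla_conj by metis
  have PQ: "P (nabla_conj n U) \<longleftrightarrow> Q U" if U: "U \<in> carrier_mat n n" for U
  proof -
    have "nabla_conj n A = nabla_conj n U * nabla_conj n B * (nabla_conj n U)\<^sup>T \<longleftrightarrow> A = U * B * U\<^sup>T"
      using carr U by (subst nabla_conj_congruence[symmetric]) (simp_all add: inj)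
    then show ?thesis
      unfolding P_def Q_def using U
      by (simp add: lower_triangular_nabla_conj_iff nabla_conj_diag_iff)
  qed
  have carr_PQ: "P L \<Longrightarrow> L \<in> carrier_mat n n" "Q L \<Longrightarrow> L \<in> carrier_mat n n" for L
    by (simp_all add: P_def Q_def)
  have "\<exists>!L. P L"
    unfolding P_def using A B carr
    by (intro LPM_ex1_lower_triangular_congruence[OF F \<epsilon>]) (simp_all add: LPM_nabla_conj_iff)
  then obtain L where L: "P L" "\<And>M. P M \<Longrightarrow> M = L"
    by blast
  have "\<exists>!U. Q U"
  proof (rule ex1I)
    show "Q (nabla_conj n L)"
      using PQ[of "nabla_conj n L"] carr_PQ(1)[OF L(1)] L(1) by (simp add: nabla_conj_nabla_conj)
    show "U = nabla_conj n L" if "Q U" for U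
      using L(2)[of "nabla_conj n U"] PQ[of U] carr_PQ(2)[OF that] that
      by (metis nabla_conj_nabla_conj)
  qed
  then show ?thesis
    unfolding Q_def .
qed

section \<open>Inverses\<close>

text \<open>Jacobi's complementary minor formula for trailing blocks. Replacing the first \<open>k\<close> columns of
  \<open>B\<close> by unit vectors gives a matrix \<open>C\<close> of determinant \<open>det (trailing_block m B)\<close>, and in \<open>A C\<close>
  the last \<open>m\<close> columns are unit vectors.\<close>

lemma det_trailing_block_inverse:
  fixes A B :: "'a :: field mat"
  assumes A: "A \<in> carrier_mat (k + m) (k + m)" and B: "B \<in> carrier_mat (k + m) (k + m)"
    and AB: "A * B = 1\<^sub>m (k + m)"
  shows "det A * det (trailing_block m B) = det (leading_block k A)"
proof -
  obtain A2 A3 A4 where A': "A2 \<in> carrier_mat k m" "A3 \<in> carrier_mat m k" "A4 \<in> carrier_mat m m"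
    and A_eq: "A = four_block_mat (leading_block k A) A2 A3 A4"
    using four_block_decomposition[OF A] by metis
  obtain B2 B3 B4 where B': "B2 \<in> carrier_mat k m" "B3 \<in> carrier_mat m k" "B4 \<in> carrier_mat m m"
    and B_eq: "B = four_block_mat (leading_block k B) B2 B3 B4" and B4: "trailing_block m B = B4"
    using four_block_decomposition[OF B] by metis
  define A1 where "A1 = leading_block k A"
  define B1 where "B1 = leading_block k B"
  have c: "A1 \<in> carrier_mat k k" "B1 \<in> carrier_mat k k"
    by (simp_all add: A1_def B1_def)
  have A_eq': "A = four_block_mat A1 A2 A3 A4" and B_eq': "B = four_block_mat B1 B2 B3 B4"
    using A_eq B_eq unfolding A1_def B1_def by simp_all
  let ?C = "four_block_mat (1\<^sub>m k) B2 (0\<^sub>m m k) B4"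
  have C: "?C \<in> carrier_mat (k + m) (k + m)"
    using B' by auto
  have AB_blocks: "four_block_mat (A1 * B1 + A2 * B3) (A1 * B2 + A2 * B4) (A3 * B1 + A4 * B3)
      (A3 * B2 + A4 * B4) = four_block_mat (1\<^sub>m k) (0\<^sub>m k m) (0\<^sub>m m k) (1\<^sub>m m)"
    using AB unfolding A_eq' B_eq' using A' B' c
    by (simp add: mult_four_block_mat[of _ k k _ m _ m _ _ k _ m])
  have UR: "A1 * B2 + A2 * B4 = 0\<^sub>m k m"
  proof (rule eq_matI)
    fix i j assume "i < dim_row (0\<^sub>m k m)" "j < dim_col (0\<^sub>m k m)"
    then show "(A1 * B2 + A2 * B4) $$ (i, j) = 0\<^sub>m k m $$ (i, j)"
      using arg_cong[OF AB_blocks, of "\<lambda>M. M $$ (i, k + j)"] A' B' c by simp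
  qed (use A' B' c in auto)
  have LR: "A3 * B2 + A4 * B4 = 1\<^sub>m m"
  proof (rule eq_matI)
    fix i j assume "i < dim_row (1\<^sub>m m)" "j < dim_col (1\<^sub>m m)"
    then show "(A3 * B2 + A4 * B4) $$ (i, j) = 1\<^sub>m m $$ (i, j)"
      using arg_cong[OF AB_blocks, of "\<lambda>M. M $$ (k + i, k + j)"] A' B' c by simp
  qed (use A' B' c in auto)
  have "A * ?C = four_block_mat (A1 * 1\<^sub>m k + A2 * 0\<^sub>m m k) (A1 * B2 + A2 * B4)
      (A3 * 1\<^sub>m k + A4 * 0\<^sub>m m k) (A3 * B2 + A4 * B4)"
    unfolding A_eq' using A' B' c by (subst mult_four_block_mat[of _ k k _ m _ m _ _ k _ m]) auto
  also have "\<dots> = four_block_mat A1 (0\<^sub>m k m) A3 (1\<^sub>m m)"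
    using A' c by (simp add: UR LR)
  finally have "det A * det ?C = det (four_block_mat A1 (0\<^sub>m k m) A3 (1\<^sub>m m))"
    using det_mult[OF A C] by simp
  also have "\<dots> = det A1"
    using A' c by (subst det_four_block_mat_upper_right_zero[of _ k _ m]) auto
  also have "det ?C = det B4"
    using B' by (subst det_four_block_mat_lower_left_zero[of _ k _ m]) auto
  finally show ?thesis
    by (simp add: A1_def B4)
qed

text \<open>Transposing \<open>B * A = 1\<^sub>m n\<close> shows that \<open>B\<^sup>T\<close> is
  also a right inverse of \<open>A\<close>, and inverses are unique.\<close>

lemma symmetric_mat_inverse:
  fixes A B :: "'a :: field mat"
  assumes A: "A \<in> carrier_mat n n" "symmetric_mat A" and B: "B \<in> carrier_mat n n"
    and AB: "A * B = 1\<^sub>m n" "B * A = 1\<^sub>m n"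
  shows "symmetric_mat B"
proof -
  have "A * B\<^sup>T = 1\<^sub>m n"
    using transpose_mult[OF B A(1)] A(2) AB(2) by (simp add: symmetric_mat_def)
  then have "B * (A * B\<^sup>T) = B"
    using B by simp
  moreover have "B * (A * B\<^sup>T) = B\<^sup>T"
    using A(1) B AB(2) by (simp flip: assoc_mult_mat[of _ n n _ n _ n])
  ultimately show ?thesis
    by (simp add: symmetric_mat_def)
qed

text \<open>Both parts use the complementary minor formula for the same product
  \<open>A * B\<close>, split once as \<open>(n - k) + k\<close> and once as
  \<open>k + (n - k)\<close>; the second also uses \<open>det A = 1 / det B\<close>. The
  denominators are written as minors of size \<open>n\<close> to fit
  \<open>has_sign_inverse_pattern\<close>.\<close>

lemma det_trailing_block_inverse_divide:
  fixes A B :: "'a :: field mat"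
  assumes A: "A \<in> carrier_mat n n" and B: "B \<in> carrier_mat n n"
    and AB: "A * B = 1\<^sub>m n" and k: "k \<le> n"
  shows "det (trailing_block k B) = det (leading_block (n - k) A) / det (leading_block n A)"
    and "det (leading_block k A) = det (trailing_block (n - k) B) / det (trailing_block n B)"
proof -
  have det: "det A * det B = 1"
    using det_mult[OF A B] AB by simp
  then have nz: "det A \<noteq> 0" "det B \<noteq> 0"
    by auto
  have n: "(n - k) + k = n" "k + (n - k) = n"
    using k by auto
  have "det A * det (trailing_block k B) = det (leading_block (n - k) A)"
    using det_trailing_block_inverse[of A "n - k" k B] assms by (simp only: n)
  then show "det (trailing_block k B) = det (leading_block (n - k) A) / det (leading_block n A)"
    using nz A by (simp add: leading_block_dim field_simps)
  have "det A * det (trailing_block (n - k) B) = det (leading_block k A)"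
    using det_trailing_block_inverse[of A k "n - k" B] assms by (simp only: n)
  moreover have "det A = 1 / det B"
    using det nz by (simp add: field_simps)
  ultimately show "det (leading_block k A) = det (trailing_block (n - k) B) / det (trailing_block n B)"
    using B by (simp add: trailing_block_dim)
qed

lemma inverse_LPM:
  fixes A B :: "'a :: {field, finite} mat"
  assumes \<epsilon>: "sign_pattern n \<epsilon>" and A: "A \<in> LPM n \<epsilon>" and B: "B \<in> carrier_mat n n"
    and AB: "A * B = 1\<^sub>m n" "B * A = 1\<^sub>m n"
  shows "B \<in> TPM n (inverse_pattern n \<epsilon>)"
proof -
  have A': "A \<in> carrier_mat n n" "symmetric_mat A"
    using A by (auto simp: LPM_iff)
  have "has_sign (inverse_pattern n \<epsilon> k) (det (trailing_block k B))" if "k \<in> {1..n}" for k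
    using has_sign_inverse_pattern[OF \<epsilon> that, of "\<lambda>k. det (leading_block k A)"] A that
      det_trailing_block_inverse_divide(1)[OF A'(1) B AB(1), of k]
    by (simp add: LPM_iff)
  then show ?thesis
    using symmetric_mat_inverse[OF A' B AB] B by (simp add: TPM_iff)
qed

lemma inverse_TPM:
  fixes A B :: "'a :: {field, finite} mat"
  assumes \<epsilon>: "sign_pattern n \<epsilon>" and B: "B \<in> TPM n \<epsilon>" and A: "A \<in> carrier_mat n n"
    and AB: "A * B = 1\<^sub>m n" "B * A = 1\<^sub>m n"
  shows "A \<in> LPM n (inverse_pattern n \<epsilon>)"
proof -
  have B': "B \<in> carrier_mat n n" "symmetric_mat B"
    using B by (auto simp: TPM_iff)
  have "has_sign (inverse_pattern n \<epsilon> k) (det (leading_block k A))" if "k \<in> {1..n}" for k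
    using has_sign_inverse_pattern[OF \<epsilon> that, of "\<lambda>k. det (trailing_block k B)"] B that
      det_trailing_block_inverse_divide(2)[OF A B'(1) AB(1), of k]
    by (simp add: TPM_iff trailing_block_def)
  then show ?thesis
    using symmetric_mat_inverse[OF B' A AB(2,1)] A by (simp add: LPM_iff)
qed

section \<open>Inversion as a bijection\<close>

lemma sign_pattern_inverse_pattern: "sign_pattern n \<epsilon> \<Longrightarrow> sign_pattern n (inverse_pattern n \<epsilon>)"
  unfolding sign_pattern_def
proof
  fix k assume \<epsilon>: "\<forall>k\<in>{1..n}. \<epsilon> k \<in> {1, - 1}" and k: "k \<in> {1..n}"
  then have "\<epsilon> n \<in> {1, - 1}" "k < n \<Longrightarrow> \<epsilon> (n - k) \<in> {1, - 1}"
    by auto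
  then show "inverse_pattern n \<epsilon> k \<in> {1, - 1}"
    by (auto simp: inverse_pattern_def)
qed

text \<open>For \<open>k < n\<close> the value is
  \<open>\<epsilon> n * (\<epsilon> n * \<epsilon> k)\<close>, and \<open>\<epsilon> n\<close>
  squares to 1. Inverting twice thus returns to the original sign condition.\<close>

lemma inverse_pattern_inverse_pattern:
  assumes "sign_pattern n \<epsilon>" "k \<in> {1..n}"
  shows "inverse_pattern n (inverse_pattern n \<epsilon>) k = \<epsilon> k"
proof -
  have "\<epsilon> n \<in> {1, - 1}"
    using assms by (auto simp: sign_pattern_def)
  then have "\<epsilon> n * \<epsilon> n = 1"
    by auto
  then show ?thesis
    using assms(2) by (auto simp: inverse_pattern_def simp flip: mult.assoc)
qed

text \<open>\<open>mat_inverse\<close> yields \<open>None\<close> only for matrices that are not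
  units, so \<open>the\<close> is applied to a genuine inverse.\<close>

lemma the_mat_inverse:
  fixes A :: "'a :: field mat"
  assumes A: "A \<in> carrier_mat n n" and det: "det A \<noteq> 0"
  shows "the (mat_inverse A) \<in> carrier_mat n n" "A * the (mat_inverse A) = 1\<^sub>m n"
    "the (mat_inverse A) * A = 1\<^sub>m n"
proof -
  obtain B where "mat_inverse A = Some B"
    using mat_inverse(1)[OF A, of "()"] det_non_zero_imp_unit[OF A det, of "()"]
    by (cases "mat_inverse A") auto
  with mat_inverse(2)[OF A this]
  show "the (mat_inverse A) \<in> carrier_mat n n" "A * the (mat_inverse A) = 1\<^sub>m n"
    "the (mat_inverse A) * A = 1\<^sub>m n"
    by auto
qed

lemma the_mat_inverse_eqI:
  fixes A B :: "'a :: field mat"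
  assumes A: "A \<in> carrier_mat n n" and B: "B \<in> carrier_mat n n" and AB: "A * B = 1\<^sub>m n"
  shows "the (mat_inverse A) = B"
proof -
  let ?C = "the (mat_inverse A)"
  have "det A * det B = 1"
    using det_mult[OF A B] AB by simp
  then have "det A \<noteq> 0"
    by auto
  note C = the_mat_inverse[OF A this]
  have "?C * (A * B) = B"
    using A B C by (simp flip: assoc_mult_mat[of _ n n _ n _ n])
  then show ?thesis
    using C AB by simp
qed

lemma bij_betw_the_mat_inverse:
  assumes n: "n \<ge> 1" and \<epsilon>: "sign_pattern n \<epsilon>"
  shows "bij_betw (\<lambda>A :: 'a :: {field, finite} mat. the (mat_inverse A))
    (LPM n \<epsilon>) (TPM n (inverse_pattern n \<epsilon>))"
proof -
  let ?f = "\<lambda>A :: 'a mat. the (mat_inverse A)" and ?\<delta> = "inverse_pattern n \<epsilon>"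
  note \<delta> = sign_pattern_inverse_pattern[OF \<epsilon>]
  \<comment> \<open>Puts the full determinant among the prescribed minors, which makes all matrices
    concerned regular.\<close>
  have nn: "n \<in> {1..n}"
    using n by simp
  have LPM_inv: "A \<in> carrier_mat n n" "?f A \<in> carrier_mat n n" "A * ?f A = 1\<^sub>m n" "?f A * A = 1\<^sub>m n"
    if A: "A \<in> LPM n \<epsilon>" for A
  proof -
    show c: "A \<in> carrier_mat n n"
      using A by (simp add: LPM_iff)
    have "det A \<noteq> 0"
      using A nn \<epsilon> has_sign_nonzero[of "\<epsilon> n" "det A"] leading_block_dim[OF c]
      by (metis LPM_iff sign_pattern_def)
    then show "?f A \<in> carrier_mat n n" "A * ?f A = 1\<^sub>m n" "?f A * A = 1\<^sub>m n"
      using the_mat_inverse[OF c] by auto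
  qed
  have TPM_inv: "B \<in> carrier_mat n n" "?f B \<in> carrier_mat n n" "B * ?f B = 1\<^sub>m n" "?f B * B = 1\<^sub>m n"
    if B: "B \<in> TPM n ?\<delta>" for B
  proof -
    show c: "B \<in> carrier_mat n n"
      using B by (simp add: TPM_iff)
    have "det B \<noteq> 0"
      using B nn \<delta> has_sign_nonzero[of "?\<delta> n" "det B"] trailing_block_dim[OF c]
      by (metis TPM_iff sign_pattern_def)
    then show "?f B \<in> carrier_mat n n" "B * ?f B = 1\<^sub>m n" "?f B * B = 1\<^sub>m n"
      using the_mat_inverse[OF c] by auto
  qed
  \<comment> \<open>The doubly inverted pattern need not equal \<epsilon> as a function; it agrees
    on \<open>{1..n}\<close>, the only arguments that membership inspects.\<close>
  have LPM_eq: "LPM n (inverse_pattern n ?\<delta>) = (LPM n \<epsilon> :: 'a mat set)"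
    using inverse_pattern_inverse_pattern[OF \<epsilon>] by (auto simp: LPM_iff)
  show ?thesis
  proof (rule bij_betw_byWitness[of _ ?f])
    show "\<forall>A\<in>LPM n \<epsilon>. ?f (?f A) = A"
      using LPM_inv by (auto intro!: the_mat_inverse_eqI[of _ n])
    show "\<forall>B\<in>TPM n ?\<delta>. ?f (?f B) = B"
      using TPM_inv by (auto intro!: the_mat_inverse_eqI[of _ n])
    show "?f ` LPM n \<epsilon> \<subseteq> TPM n ?\<delta>"
    proof (rule image_subsetI)
      fix A :: "'a mat" assume A: "A \<in> LPM n \<epsilon>"
      show "?f A \<in> TPM n ?\<delta>"
        by (rule inverse_LPM[OF \<epsilon> A LPM_inv(2,3,4)[OF A]])
    qed
    show "?f ` TPM n ?\<delta> \<subseteq> LPM n \<epsilon>"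
    proof (rule image_subsetI)
      fix B :: "'a mat" assume B: "B \<in> TPM n ?\<delta>"
      show "?f B \<in> LPM n \<epsilon>"
        using inverse_TPM[OF \<delta> B TPM_inv(2,4,3)[OF B]] LPM_eq by simp
    qed
  qed
qed

theorem theorem1:
  fixes n :: nat and \<epsilon> :: "nat \<Rightarrow> int" and A\<^sub>\<epsilon> :: "'a :: {field, finite} mat"
  assumes "n \<ge> 1"
    and "sign_pattern n \<epsilon>"
    and "A\<^sub>\<epsilon> \<in> LPM n \<epsilon>"
  shows
    "(\<forall>L \<in> carrier_mat n n. lower_triangular L \<and> invertible_mat L \<longrightarrow>
        L * A\<^sub>\<epsilon> * transpose_mat L \<in> LPM n \<epsilon>)
     \<and>
     (definite_field TYPE('a) \<or> CHAR('a) = 2 \<longrightarrow>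
       (\<forall>A \<in> LPM n \<epsilon>. \<exists>!L. L \<in> carrier_mat n n \<and> lower_triangular L \<and>
          (\<forall>i<n. positive_elem (L $$ (i, i))) \<and> A = L * A\<^sub>\<epsilon> * transpose_mat L))
     \<and>
     bij_betw (\<lambda>A :: 'a mat. nabla_mat n * A * nabla_mat n) (LPM n \<epsilon>) (TPM n \<epsilon>)
     \<and>
     bij_betw (\<lambda>A :: 'a mat. the (mat_inverse A)) (LPM n \<epsilon>) (TPM n (inverse_pattern n \<epsilon>))
     \<and>
     (\<forall>B \<in> (TPM n \<epsilon> :: 'a mat set).
       (\<forall>U \<in> carrier_mat n n. upper_triangular U \<and> invertible_mat U \<longrightarrow>
          U * B * transpose_mat U \<in> TPM n \<epsilon>)
       \<and>
       (definite_field TYPE('a) \<or> CHAR('a) = 2 \<longrightarrow>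
         (\<forall>A \<in> TPM n \<epsilon>. \<exists>!U. U \<in> carrier_mat n n \<and> upper_triangular U \<and>
            (\<forall>i<n. positive_elem (U $$ (i, i))) \<and> A = U * B * transpose_mat U)))"
  (is "?c1 \<and> ?c2 \<and> ?c3 \<and> ?c4 \<and> ?c5")
proof (intro conjI)
  show ?c1
    using LPM_lower_triangular_congruence[OF assms(3)] by blast
  show ?c2
    using LPM_ex1_lower_triangular_congruence[OF _ assms(2) _ assms(3)] by blast
  show ?c3
    using bij_betw_nabla_conj[of n \<epsilon>] unfolding nabla_conj_def[abs_def] .
  show ?c4
    by (rule bij_betw_the_mat_inverse[OF assms(1,2)])
  show ?c5
  proof (intro ballI conjI impI)
    fix B U :: "'a mat"
    assume "B \<in> TPM n \<epsilon>" "U \<in> carrier_mat n n" "upper_triangular U \<and> invertible_mat U"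
    then show "U * B * U\<^sup>T \<in> TPM n \<epsilon>"
      by (intro TPM_upper_triangular_congruence) auto
  next
    fix B A :: "'a mat"
    assume "B \<in> TPM n \<epsilon>" "definite_field TYPE('a) \<or> CHAR('a) = 2" "A \<in> TPM n \<epsilon>"
    then show "\<exists>!U. U \<in> carrier_mat n n \<and> upper_triangular U \<and>
        (\<forall>i<n. positive_elem (U $$ (i, i))) \<and> A = U * B * U\<^sup>T"
      by (intro TPM_ex1_upper_triangular_congruence[OF _ assms(2)])
  qed
qed

end
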